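(* Let $m\ge 3$ be an integer, let $p_1,p_2,\dots,p_m\in\mathbb{C}[x]$ be nonzero polynomials and let $k_1,k_2,\dots,k_m$ be positive integers. Suppose that $$\gcd\left(p_1^{k_1},p_2^{k_2},\dots,p_m^{k_m}\right)=1,\qquad p_1^{k_1}+p_2^{k_2}+\dots+p_m^{k_m}=0,$$ and that any $m-1$ of the $m$ polynomials $p_1^{k_1},\dots,p_m^{k_m}$ are linearly independent over $\mathbb{C}$ (that is, for every index $j\in\{1,\dots,m\}$ the family $(p_i^{k_i})_{i\ne j}$ is linearly independent). Then $$\min\{k_1,k_2,\dots,k_m\}<\frac{1}{3}\left(m^3+7m^2-49m+68\right).$$
   Context: The gcd condition means that the $m$ polynomials have no common nonconstant divisor in $\mathbb{C}[x]$ (they are not required to be pairwise coprime). *)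

theory Defs
  imports Complex_Main
    "HOL-Computational_Algebra.Computational_Algebra"
    "HOL-Computational_Algebra.Field_as_Ring"
begin

text \<open>
  The library's \<^const>\<open>module.dependent\<close> is about sets of vectors. Here linear independence is
  that of an indexed family, so equal members at different indices count as dependent.
  The index set is meant to be finite: over an infinite one the library's \<^const>\<open>sum\<close> is \<open>0\<close>.
\<close>

definition lin_indep_family :: "'i set \<Rightarrow> ('i \<Rightarrow> 'a::field poly) \<Rightarrow> bool" where
  "lin_indep_family I f \<longleftrightarrow>
     (\<forall>c :: 'i \<Rightarrow> 'a. (\<Sum>i\<in>I. smult (c i) (f i)) = 0 \<longrightarrow> (\<forall>i\<in>I. c i = 0))"

lemma module_smult: "module (smult :: 'a::field \<Rightarrow> 'a poly \<Rightarrow> 'a poly)"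
  by unfold_locales (auto simp: smult_add_left smult_add_right)

lemma lin_indep_family_iff_independent:
  fixes f :: "'i \<Rightarrow> 'a::field poly"
  assumes "finite I"
  shows "lin_indep_family I f \<longleftrightarrow> inj_on f I \<and> \<not> module.dependent smult (f ` I)"
proof
  assume L: "lin_indep_family I f"
  have inj: "inj_on f I"
  proof (rule inj_onI, rule ccontr)
    fix i j assume ij: "i \<in> I" "j \<in> I" "f i = f j" "i \<noteq> j"
    define c where "c = (\<lambda>l. if l = i then 1 else if l = j then -1 else (0 :: 'a))"
    have "(\<Sum>l\<in>I. smult (c l) (f l)) = (\<Sum>l\<in>{i,j}. smult (c l) (f l))"
      using assms ij by (intro sum.mono_neutral_right) (auto simp: c_def)
    also have "\<dots> = 0" using ij by (simp add: c_def)
    finally have "c i = 0" using L ij unfolding lin_indep_family_def by blast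
    then show False by (simp add: c_def)
  qed
  moreover have "\<not> module.dependent smult (f ` I)"
  proof
    assume "module.dependent smult (f ` I)"
    then obtain u where u: "\<exists>v\<in>f ` I. u v \<noteq> 0" "(\<Sum>v\<in>f ` I. smult (u v) v) = 0"
      using module.dependent_finite[OF module_smult, of "f ` I"] assms by auto
    have "(\<Sum>i\<in>I. smult ((u \<circ> f) i) (f i)) = 0"
      using u(2) by (simp add: sum.reindex[OF inj])
    then have "\<forall>i\<in>I. (u \<circ> f) i = 0" using L unfolding lin_indep_family_def by blast
    then show False using u(1) by auto
  qed
  ultimately show "inj_on f I \<and> \<not> module.dependent smult (f ` I)" by blast
next
  assume R: "inj_on f I \<and> \<not> module.dependent smult (f ` I)"
  show "lin_indep_family I f"
    unfolding lin_indep_family_def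
  proof (intro allI impI)
    fix c :: "'i \<Rightarrow> 'a" assume c: "(\<Sum>i\<in>I. smult (c i) (f i)) = 0"
    define u where "u = (\<lambda>v. c (inv_into I f v))"
    have "(\<Sum>v\<in>f ` I. smult (u v) v) = (\<Sum>i\<in>I. smult (u (f i)) (f i))"
      using R by (simp add: sum.reindex)
    also have "\<dots> = 0" using R c by (simp add: u_def)
    finally have "\<forall>v\<in>f ` I. u v = 0"
      using R module.dependent_finite[OF module_smult, of "f ` I"] assms by blast
    then show "\<forall>i\<in>I. c i = 0" using R by (simp add: u_def)
  qed
qed

lemma Gcd_poly_eq_1_iff:
  fixes A :: "complex poly set"
  assumes "A \<noteq> {}" "0 \<notin> A"
  shows "Gcd A = 1 \<longleftrightarrow> (\<forall>d. (\<forall>a\<in>A. d dvd a) \<longrightarrow> degree d = 0)"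
proof
  assume G: "Gcd A = 1"
  show "\<forall>d. (\<forall>a\<in>A. d dvd a) \<longrightarrow> degree d = 0"
  proof (intro allI impI)
    fix d assume "\<forall>a\<in>A. d dvd a"
    then have "d dvd Gcd A" by (blast intro: Gcd_greatest)
    then have "is_unit d" using G by simp
    then show "degree d = 0" by (metis is_unit_iff_degree dvd_0_left_iff zero_neq_one)
  qed
next
  assume D: "\<forall>d. (\<forall>a\<in>A. d dvd a) \<longrightarrow> degree d = 0"
  have nz: "Gcd A \<noteq> 0" using assms by (auto simp: Gcd_0_iff)
  have "degree (Gcd A) = 0" using D by (blast intro: Gcd_dvd)
  with nz have "is_unit (Gcd A)" by (simp add: is_unit_iff_degree)
  then have "normalize (Gcd A) = 1" by (simp only: is_unit_normalize)
  then show "Gcd A = 1" by simp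
qed

end

theory Submission
  imports Defs "Jordan_Normal_Form.Determinant"
begin

text \<open>
  Put \<open>n = m - 1\<close> and let \<open>W\<close> be the Wronskian of \<open>n\<close> of the powers \<open>p\<^sub>i ^ k\<^sub>i\<close>. It is nonzero, and
  since the powers sum to zero it depends only up to a unit on which power is left out.
  Every row of the Wronskian matrix belonging to \<open>p\<^sub>i\<close> is divisible by \<open>p\<^sub>i ^ (k\<^sub>i - (n - 1))\<close>; as each
  prime fails to divide some \<open>p\<^sub>j\<close>, leaving out that one shows that the product of these factors
  over all \<open>m\<close> indices divides \<open>W\<close>. Comparing with the degree of \<open>W\<close>, where a power of maximal degree
  \<open>D\<close> is left out, gives \<open>D \<le> (m - 2) * (\<Sum>i. degree p\<^sub>i) \<le> (m - 2) * m * D / min k\<close>, so that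
  \<open>min k \<le> m * (m - 2)\<close>, which is below the cubic bound.
\<close>

hide_const (open) Module.smult

section \<open>Divisibility and vanishing order under repeated differentiation\<close>

lemma power_dvd_pderiv:
  fixes a f :: "'a::field_char_0 poly"
  assumes "a ^ k dvd f"
  shows "a ^ (k - 1) dvd pderiv f"
proof -
  obtain h where "f = a ^ k * h" using assms by (auto elim: dvdE)
  then have "pderiv f = a ^ k * pderiv h + h * smult (of_nat k) (a ^ (k - 1)) * pderiv a"
    by (simp add: pderiv_mult pderiv_power mult_ac)
  moreover have "a ^ (k - 1) dvd a ^ k * pderiv h" by (simp add: le_imp_power_dvd)
  moreover have "a ^ (k - 1) dvd h * smult (of_nat k) (a ^ (k - 1)) * pderiv a"
    by (simp add: dvd_smult)
  ultimately show ?thesis by (simp only: dvd_add)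
qed

lemma power_dvd_higher_pderiv:
  fixes a f :: "'a::field_char_0 poly"
  assumes "a ^ k dvd f"
  shows "a ^ (k - r) dvd (pderiv ^^ r) f"
proof (induction r)
  case (Suc r)
  from power_dvd_pderiv[OF Suc] show ?case by (simp add: diff_diff_add)
qed (use assms in simp)

lemma order_higher_pderiv:
  fixes f :: "'a::field_char_0 poly"
  assumes "f \<noteq> 0" "r \<le> order z f"
  shows "(pderiv ^^ r) f \<noteq> 0 \<and> order z ((pderiv ^^ r) f) = order z f - r"
  using assms(2)
proof (induction r)
  case (Suc r)
  let ?h = "(pderiv ^^ r) f"
  from Suc have h: "?h \<noteq> 0" "order z ?h = order z f - r" "order z ?h \<noteq> 0" by auto
  have "pderiv ?h \<noteq> 0"
  proof
    assume "pderiv ?h = 0"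
    then have "degree ?h = 0" by (simp add: pderiv_eq_0_iff)
    with h(1) order_degree[of ?h z] h(3) show False by simp
  qed
  moreover have "order z ?h = Suc (order z (pderiv ?h))"
    using h by (intro order_pderiv) (simp_all add: order_root)
  ultimately show ?case using h by simp
qed (use assms in simp)

text \<open>For \<open>g \<noteq> 0\<close> of order \<open>e\<close> at \<open>z\<close>, the
  initial conditions force \<open>s \<le> e\<close>. The leading term of the equation then has order
  exactly \<open>e - s\<close>, while all lower terms vanish to a higher order, so the terms cannot
  cancel.\<close>

lemma poly_linear_ode_unique:
  fixes g :: "'a::field_char_0 poly"
  assumes lead: "poly (b s) z \<noteq> 0"
    and ode: "(\<Sum>r\<le>s. b r * (pderiv ^^ r) g) = 0"
    and init: "\<And>t. t < s \<Longrightarrow> poly ((pderiv ^^ t) g) z = 0"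
  shows "g = 0"
proof (rule ccontr)
  assume g: "g \<noteq> 0"
  define e where "e = order z g"
  have "s \<le> e"
  proof (rule ccontr)
    assume "\<not> s \<le> e"
    then show False
      using order_higher_pderiv[OF g, of e z] init[of e] by (auto simp: e_def order_root)
  qed
  let ?l = "[:- z, 1:] ^ Suc (e - s)"
  have "?l dvd (\<Sum>r<s. b r * (pderiv ^^ r) g)"
  proof (intro dvd_sum dvd_mult)
    fix t assume "t \<in> {..<s}"
    then show "?l dvd (pderiv ^^ t) g"
      using order_higher_pderiv[OF g, of t z] \<open>s \<le> e\<close>
      by (subst order_divides) (auto simp: e_def)
  qed
  moreover have "b s * (pderiv ^^ s) g = - (\<Sum>r<s. b r * (pderiv ^^ r) g)"
    using ode by (simp add: lessThan_Suc_atMost[symmetric] add_eq_0_iff)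
  ultimately have "?l dvd b s * (pderiv ^^ s) g" by (simp only: dvd_minus_iff)
  moreover have nz: "b s * (pderiv ^^ s) g \<noteq> 0"
    using order_higher_pderiv[OF g, of s z] \<open>s \<le> e\<close> lead by (auto simp: e_def)
  moreover have "order z (b s * (pderiv ^^ s) g) = e - s"
    using order_higher_pderiv[OF g, of s z] \<open>s \<le> e\<close> order_mult[OF nz, of z] order_0I[OF lead]
    by (simp add: e_def)
  ultimately show False by (simp only: order_divides) simp
qed

section \<open>The Wronskian and linear dependence\<close>

definition wronskian :: "nat \<Rightarrow> (nat \<Rightarrow> 'a::field_char_0 poly) \<Rightarrow> 'a poly" where
  "wronskian n f = det (mat n n (\<lambda>(i, r). (pderiv ^^ r) (f i)))"

text \<open>
  A vanishing Wronskian yields a linear differential operator of some order \<open>s < n\<close> annihilating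
  every \<open>f i\<close>. At a point \<open>z\<close> where its leading coefficient is nonzero, some nontrivial combination
  of the \<open>f i\<close> vanishes to order \<open>s\<close>, hence identically.
\<close>

lemma wronskian_eq_0_imp_dependent:
  fixes f :: "nat \<Rightarrow> 'a::field_char_0 poly"
  assumes "wronskian n f = 0"
  shows "\<exists>c. (\<exists>i<n. c i \<noteq> 0) \<and> (\<Sum>i<n. smult (c i) (f i)) = 0"
proof -
  obtain v where v: "v \<in> carrier_vec n" "v \<noteq> 0\<^sub>v n"
    and v0: "mat n n (\<lambda>(i, r). (pderiv ^^ r) (f i)) *\<^sub>v v = 0\<^sub>v n"
    using assms det_0_iff_vec_prod_zero[of "mat n n (\<lambda>(i, r). (pderiv ^^ r) (f i))" n]
    by (auto simp: wronskian_def)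
  define R where "R = {r. r < n \<and> v $ r \<noteq> 0}"
  have "finite R" by (simp add: R_def)
  have "R \<noteq> {}" using v by (auto simp: R_def intro!: eq_vecI)
  \<comment> \<open>The last nonzero coordinate of the kernel vector is the leading coefficient of
    the operator, and its index is the order.\<close>
  define s where "s = Max R"
  have "s \<in> R" using \<open>finite R\<close> \<open>R \<noteq> {}\<close> by (simp add: s_def)
  then have s: "s < n" "v $ s \<noteq> 0" by (auto simp: R_def)
  have above: "v $ r = 0" if "s < r" "r < n" for r
  proof (rule ccontr)
    assume "v $ r \<noteq> 0"
    with that have "r \<in> R" by (simp add: R_def)
    then have "r \<le> s" using \<open>finite R\<close> by (simp add: s_def)
    with that show False by simp
  qed
  have ode: "(\<Sum>r\<le>s. v $ r * (pderiv ^^ r) (f i)) = 0" if "i < n" for i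
  proof -
    have "(\<Sum>r<n. v $ r * (pderiv ^^ r) (f i)) = (mat n n (\<lambda>(i, r). (pderiv ^^ r) (f i)) *\<^sub>v v) $ i"
      using v that by (simp add: scalar_prod_def mult.commute lessThan_atLeast0)
    also have "\<dots> = 0" using v0 that by simp
    also have "(\<Sum>r<n. v $ r * (pderiv ^^ r) (f i)) = (\<Sum>r\<le>s. v $ r * (pderiv ^^ r) (f i))"
      using s above by (intro sum.mono_neutral_right) auto
    finally show ?thesis .
  qed
  have "finite {z. poly (v $ s) z = 0}" using s by (simp add: poly_roots_finite)
  then obtain z where z: "poly (v $ s) z \<noteq> 0"
    using infinite_UNIV_char_0[where 'a='a] by (metis (mono_tags) UNIV_eq_I mem_Collect_eq)
  \<comment> \<open>Fewer than \<open>n\<close> linear conditions on \<open>c\<close>, padded with zero rows to a square system.\<close>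
  define C where "C = mat n n (\<lambda>(t, i). if t < s then poly ((pderiv ^^ t) (f i)) z else 0)"
  have C: "C \<in> carrier_mat n n" by (simp add: C_def)
  have "det C = 0"
    unfolding det_def'[OF C]
  proof (intro sum.neutral ballI)
    fix \<sigma> assume "\<sigma> \<in> {\<sigma>. \<sigma> permutes {0..<n}}"
    \<comment> \<open>Every Leibniz product takes an entry of row \<open>s\<close>, which is one of
      the zero rows because \<open>s < n\<close>.\<close>
    then have "\<sigma> s < n" using s permutes_in_image[of \<sigma> "{0..<n}" s] by auto
    then have "C $$ (s, \<sigma> s) = 0" using s by (simp add: C_def)
    then have "(\<Prod>i = 0..<n. C $$ (i, \<sigma> i)) = 0" using s by auto
    then show "signof \<sigma> * (\<Prod>i = 0..<n. C $$ (i, \<sigma> i)) = 0" by simp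
  qed
  then obtain c where c: "c \<in> carrier_vec n" "c \<noteq> 0\<^sub>v n" and c0: "C *\<^sub>v c = 0\<^sub>v n"
    using det_0_iff_vec_prod_zero[OF C] by auto
  define g where "g = (\<Sum>i<n. smult (c $ i) (f i))"
  have "g = 0"
  proof (rule poly_linear_ode_unique[where b = "\<lambda>r. v $ r", OF z])
    have smult_sum_right: "smult a (\<Sum>r\<le>s. h r) = (\<Sum>r\<le>s. smult a (h r))"
      for a and h :: "nat \<Rightarrow> 'a poly"
      using sum_distrib_left[of "[:a:]" h "{..s}"] by simp
    have "(\<Sum>r\<le>s. v $ r * (pderiv ^^ r) g)
        = (\<Sum>r\<le>s. \<Sum>i<n. smult (c $ i) (v $ r * (pderiv ^^ r) (f i)))"
      by (simp add: g_def higher_pderiv_sum higher_pderiv_smult sum_distrib_left)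
    also have "\<dots> = (\<Sum>i<n. smult (c $ i) (\<Sum>r\<le>s. v $ r * (pderiv ^^ r) (f i)))"
      by (subst sum.swap) (simp add: smult_sum_right)
    also have "\<dots> = 0" using ode by simp
    finally show "(\<Sum>r\<le>s. v $ r * (pderiv ^^ r) g) = 0" .
  next
    fix t assume t: "t < s"
    have "poly ((pderiv ^^ t) g) z = (C *\<^sub>v c) $ t"
      using t s c
      by (simp add: g_def C_def higher_pderiv_sum higher_pderiv_smult poly_sum scalar_prod_def
          mult.commute lessThan_atLeast0)
    then show "poly ((pderiv ^^ t) g) z = 0" using c0 t s by simp
  qed
  moreover have "\<exists>i<n. c $ i \<noteq> 0" using c by (auto intro!: eq_vecI)
  ultimately show ?thesis unfolding g_def by blast
qed

section \<open>Row factors and row degrees of determinants, exchange of functions\<close>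

text \<open>Each Leibniz product takes exactly one entry from every row. The same observation gives
  the degree bound that follows.\<close>

lemma prod_dvd_det:
  fixes A :: "'a::comm_ring_1 mat"
  assumes A: "A \<in> carrier_mat n n"
    and d: "\<And>i r. i < n \<Longrightarrow> r < n \<Longrightarrow> d i dvd A $$ (i, r)"
  shows "(\<Prod>i<n. d i) dvd det A"
  unfolding det_def'[OF A]
proof (intro dvd_sum dvd_mult)
  fix \<sigma> assume "\<sigma> \<in> {\<sigma>. \<sigma> permutes {0..<n}}"
  then have "\<sigma> i < n" if "i < n" for i using that permutes_in_image[of \<sigma> "{0..<n}" i] by auto
  then show "(\<Prod>i<n. d i) dvd (\<Prod>i = 0..<n. A $$ (i, \<sigma> i))"
    unfolding lessThan_atLeast0 using d by (intro prod_dvd_prod) auto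
qed

lemma degree_det_le_sum_rows:
  fixes A :: "'a::idom poly mat"
  assumes A: "A \<in> carrier_mat n n"
    and d: "\<And>i r. i < n \<Longrightarrow> r < n \<Longrightarrow> degree (A $$ (i, r)) \<le> d i"
  shows "degree (det A) \<le> (\<Sum>i<n. d i)"
  unfolding det_def'[OF A]
proof (intro degree_sum_le)
  fix \<sigma> assume "\<sigma> \<in> {\<sigma>. \<sigma> permutes {0..<n}}"
  then have s: "\<sigma> i < n" if "i < n" for i using that permutes_in_image[of \<sigma> "{0..<n}" i] by auto
  have "degree (signof \<sigma> * (\<Prod>i = 0..<n. A $$ (i, \<sigma> i))) \<le> degree (\<Prod>i = 0..<n. A $$ (i, \<sigma> i))"
    by (auto simp: sign_def)
  also have "\<dots> \<le> (\<Sum>i = 0..<n. degree (A $$ (i, \<sigma> i)))"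
    using degree_prod_sum_le[of "{0..<n}" "\<lambda>i. A $$ (i, \<sigma> i)"] by (simp add: o_def)
  also have "\<dots> \<le> (\<Sum>i<n. d i)" unfolding lessThan_atLeast0 using d s by (intro sum_mono) auto
  finally show "degree (signof \<sigma> * (\<Prod>i = 0..<n. A $$ (i, \<sigma> i))) \<le> (\<Sum>i<n. d i)" .
qed (simp add: finite_permutations)

text \<open>Replacing row \<open>j\<close> by minus the sum of all rows is left multiplication by an involutory matrix.\<close>

lemma wronskian_exchange:
  fixes f :: "nat \<Rightarrow> 'a::field_char_0 poly"
  assumes sum0: "(\<Sum>i\<le>n. f i) = 0" and j: "j < n"
  obtains u where "is_unit u" "wronskian n (f(j := f n)) = u * wronskian n f"
proof -
  define A where "A = (\<lambda>f :: nat \<Rightarrow> 'a poly. mat n n (\<lambda>(i, r). (pderiv ^^ r) (f i)))"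
  define T :: "'a poly mat"
    where "T = mat n n (\<lambda>(i, l). if i = j then - 1 else if i = l then 1 else 0)"
  have carr: "A f \<in> carrier_mat n n" "T \<in> carrier_mat n n" for f by (auto simp: A_def T_def)
  have fn: "f n = - (\<Sum>l<n. f l)"
    using sum0 by (simp add: lessThan_Suc_atMost[symmetric] add_eq_0_iff2)
  have Tmult: "(T * B) $$ (i, r) = (if i = j then - (\<Sum>l<n. B $$ (l, r)) else B $$ (i, r))"
    if "i < n" "r < n" "B \<in> carrier_mat n n" for i r B
    using that
    by (auto simp: T_def scalar_prod_def lessThan_atLeast0 sum_negf if_distrib[of "\<lambda>x. x * _"]
        cong: if_cong)
  have "A (f(j := f n)) = T * A f"
  proof (intro eq_matI)
    fix i r assume "i < dim_row (T * A f)" "r < dim_col (T * A f)"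
    then have ir: "i < n" "r < n" by (auto simp: A_def T_def)
    have "(pderiv ^^ r) (f n) = - (\<Sum>l<n. (pderiv ^^ r) (f l))"
      using higher_pderiv_smult[of r "- 1" "\<Sum>l<n. f l"]
      by (simp add: fn higher_pderiv_sum)
    then show "A (f(j := f n)) $$ (i, r) = (T * A f) $$ (i, r)"
      using ir by (simp add: Tmult carr) (simp add: A_def)
  qed (auto simp: A_def T_def)
  then have eq: "wronskian n (f(j := f n)) = det T * wronskian n f"
    using det_mult[OF carr(2) carr(1)] unfolding wronskian_def A_def by simp
  have "T * T = 1\<^sub>m n"
  proof (intro eq_matI)
    fix i r assume "i < dim_row (1\<^sub>m n :: 'a poly mat)" "r < dim_col (1\<^sub>m n :: 'a poly mat)"
    then have ir: "i < n" "r < n" by auto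
    \<comment> \<open>Row \<open>j\<close> of \<open>T * T\<close> consists of the negated column
      sums of \<open>T\<close>; the \<open>-1\<close> in row \<open>j\<close> cancels the diagonal 1
      in every column except column \<open>j\<close>.\<close>
    have "(\<Sum>l<n. T $$ (l, r)) = (\<Sum>l\<in>{..<n} - {j}. T $$ (l, r)) - 1"
      using j ir by (subst sum.remove[of _ j]) (auto simp: T_def)
    also have "(\<Sum>l\<in>{..<n} - {j}. T $$ (l, r)) = (\<Sum>l\<in>{..<n} - {j}. if l = r then 1 else 0)"
      using ir by (intro sum.cong) (auto simp: T_def)
    finally have "(\<Sum>l<n. T $$ (l, r)) = (if r = j then - 1 else 0)"
      using ir by simp
    then show "(T * T) $$ (i, r) = 1\<^sub>m n $$ (i, r)"
      using ir by (simp add: Tmult carr) (auto simp: T_def)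
  qed (auto simp: T_def)
  then have "det T * det T = 1" using det_mult[OF carr(2) carr(2)] by simp
  then have "is_unit (det T)" by (metis dvd_triv_left)
  with eq that show ?thesis by blast
qed

section \<open>Degree inequality for vanishing sums of powers\<close>

text \<open>Divisibility is tested one prime at a time: if \<open>\<pi>\<close> does not divide
  \<open>p j\<close>, leaving out the power with index \<open>j\<close> loses no multiplicity at
  \<open>\<pi>\<close>. Truncated subtraction turns the factor into 1 when
  \<open>k i < n\<close>.\<close>

lemma prod_power_dvd_wronskian:
  fixes p :: "nat \<Rightarrow> 'a::{field_char_0,field_gcd} poly"
  assumes sum0: "(\<Sum>i\<le>n. p i ^ k i) = 0"
    and nz: "\<And>i. i \<le> n \<Longrightarrow> p i \<noteq> 0"
    and coprime: "\<And>\<pi>. prime \<pi> \<Longrightarrow> \<exists>j\<le>n. \<not> \<pi> dvd p j"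
    and W: "wronskian n (\<lambda>i. p i ^ k i) \<noteq> 0"
  shows "(\<Prod>i\<le>n. p i ^ (k i - (n - 1))) dvd wronskian n (\<lambda>i. p i ^ k i)"
proof -
  define f where "f = (\<lambda>i. p i ^ k i)"
  define q where "q = (\<lambda>i. p i ^ (k i - (n - 1)))"
  have row: "q i dvd (pderiv ^^ r) (f i)" if "r < n" for i r
  proof -
    have "q i dvd p i ^ (k i - r)" unfolding q_def using that by (intro le_imp_power_dvd) auto
    also have "\<dots> dvd (pderiv ^^ r) (f i)" unfolding f_def by (intro power_dvd_higher_pderiv) simp
    finally show ?thesis .
  qed
  have omit: "(\<Prod>i\<in>{..n} - {j}. q i) dvd wronskian n f" if "j \<le> n" for j
  proof (cases "j = n")
    case True
    then have "{..n} - {j} = {..<n}" by auto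
    moreover have "(\<Prod>i<n. q i) dvd wronskian n f"
      unfolding wronskian_def by (rule prod_dvd_det) (auto simp: row)
    ultimately show ?thesis by simp
  next
    case False
    with that have j: "j < n" by simp
    obtain u where u: "is_unit u" "wronskian n (f(j := f n)) = u * wronskian n f"
      using wronskian_exchange[of f n j] sum0 j by (auto simp: f_def)
    \<comment> \<open>Row \<open>j\<close> now carries the function with index \<open>n\<close>, so
      its divisor becomes \<open>q n\<close> as well.\<close>
    have "(\<Prod>i<n. (q(j := q n)) i) dvd wronskian n (f(j := f n))"
      unfolding wronskian_def by (rule prod_dvd_det) (auto simp: row)
    moreover have "(\<Prod>i<n. (q(j := q n)) i) = q n * (\<Prod>i\<in>{..<n} - {j}. q i)"
      using j by (subst prod.remove[of _ j]) (auto intro!: prod.cong)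
    moreover have "{..n} - {j} = insert n ({..<n} - {j})" using j by auto
    ultimately show ?thesis using u by (simp add: dvd_mult_unit_iff')
  qed
  have q0: "q i \<noteq> 0" if "i \<le> n" for i using nz[OF that] by (simp add: q_def)
  have "(\<Prod>i\<le>n. q i) dvd wronskian n f"
  proof (rule multiplicity_le_imp_dvd)
    show "(\<Prod>i\<le>n. q i) \<noteq> 0" using q0 by simp
    fix \<pi> :: "'a poly" assume \<pi>: "prime \<pi>"
    from coprime[OF \<pi>] obtain j where j: "j \<le> n" "\<not> \<pi> dvd p j" by auto
    have "\<not> \<pi> dvd q j" using j \<pi> by (auto simp: q_def dest: prime_dvd_power)
    have "multiplicity \<pi> (\<Prod>i\<le>n. q i) = multiplicity \<pi> (q j * (\<Prod>i\<in>{..n} - {j}. q i))"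
      using j by (subst prod.remove[of _ j]) auto
    also have "\<dots> = multiplicity \<pi> (\<Prod>i\<in>{..n} - {j}. q i)"
      using \<pi> q0 j \<open>\<not> \<pi> dvd q j\<close>
      by (subst prime_elem_multiplicity_mult_distrib) (auto simp: not_dvd_imp_multiplicity_0)
    also have "\<dots> \<le> multiplicity \<pi> (wronskian n f)"
      using omit[OF j(1)] W by (intro dvd_imp_multiplicity_le) (auto simp: f_def)
    finally show "multiplicity \<pi> (\<Prod>i\<le>n. q i) \<le> multiplicity \<pi> (wronskian n f)" .
  qed
  then show ?thesis by (simp add: f_def q_def)
qed

text \<open>The product dividing the Wronskian bounds its degree from below, and the other powers,
  with index \<open>j\<close> left out, bound it from above. Comparing the two, the degrees of the
  powers other than \<open>j\<close> cancel.\<close>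

lemma degree_power_sum_zero_le:
  fixes p :: "nat \<Rightarrow> 'a::{field_char_0,field_gcd} poly"
  assumes sum0: "(\<Sum>i\<le>n. p i ^ k i) = 0"
    and nz: "\<And>i. i \<le> n \<Longrightarrow> p i \<noteq> 0"
    and coprime: "\<And>\<pi>. prime \<pi> \<Longrightarrow> \<exists>j\<le>n. \<not> \<pi> dvd p j"
    and W: "wronskian n (\<lambda>i. p i ^ k i) \<noteq> 0"
    and j: "j \<le> n"
  shows "k j * degree (p j) \<le> (n - 1) * (\<Sum>i\<le>n. degree (p i))"
proof -
  define f where "f = (\<lambda>i. p i ^ k i)"
  have degf: "degree (f i) = k i * degree (p i)" if "i \<le> n" for i
    using nz[OF that] by (simp add: f_def degree_power_eq)
  have bound: "degree (wronskian n h) \<le> (\<Sum>i<n. degree (h i))" for h :: "nat \<Rightarrow> 'a poly"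
    unfolding wronskian_def by (rule degree_det_le_sum_rows) (auto simp: degree_higher_pderiv)
  have omit: "degree (wronskian n f) \<le> (\<Sum>i\<in>{..n} - {j}. degree (f i))"
  proof (cases "j = n")
    case True
    then have "{..n} - {j} = {..<n}" by auto
    then show ?thesis using bound[of f] by simp
  next
    case False
    with j have j: "j < n" by simp
    obtain u where u: "is_unit u" "wronskian n (f(j := f n)) = u * wronskian n f"
      using wronskian_exchange[of f n j] sum0 j by (auto simp: f_def)
    have "u \<noteq> 0" using u(1) by auto
    with u(1) have "degree u = 0" by (simp add: is_unit_iff_degree)
    then have "degree (wronskian n f) = degree (wronskian n (f(j := f n)))"
      using W \<open>u \<noteq> 0\<close> unfolding u(2) by (subst degree_mult_eq) (simp_all add: f_def)
    also have "\<dots> \<le> (\<Sum>i<n. degree ((f(j := f n)) i))" by (rule bound)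
    also have "\<dots> = degree (f n) + (\<Sum>i\<in>{..<n} - {j}. degree (f i))"
      using j by (subst sum.remove[of _ j]) (auto intro!: sum.cong)
    also have "\<dots> = (\<Sum>i\<in>{..n} - {j}. degree (f i))"
    proof -
      have "{..n} - {j} = insert n ({..<n} - {j})" using j by auto
      then show ?thesis by simp
    qed
    finally show ?thesis .
  qed
  \<comment> \<open>The estimate \<open>k i \<le> (k i - (n - 1)) + (n - 1)\<close> also covers
    exponents for which the subtraction truncates to 0.\<close>
  have "(\<Sum>i\<le>n. degree (f i)) \<le> (\<Sum>i\<le>n. (k i - (n - 1)) * degree (p i) + (n - 1) * degree (p i))"
    by (intro sum_mono) (simp add: degf flip: add_mult_distrib, arith)
  also have "\<dots> = (\<Sum>i\<le>n. (k i - (n - 1)) * degree (p i)) + (n - 1) * (\<Sum>i\<le>n. degree (p i))"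
    by (simp add: sum.distrib sum_distrib_left)
  also have "(\<Sum>i\<le>n. (k i - (n - 1)) * degree (p i)) = degree (\<Prod>i\<le>n. p i ^ (k i - (n - 1)))"
    using nz by (subst degree_prod_eq_sum_degree) (auto simp: degree_power_eq)
  also have "\<dots> \<le> degree (wronskian n f)"
    using dvd_imp_degree_le[OF prod_power_dvd_wronskian[OF sum0 nz coprime W] W]
    by (simp add: f_def)
  also note omit
  finally have "(\<Sum>i\<le>n. degree (f i))
      \<le> (\<Sum>i\<in>{..n} - {j}. degree (f i)) + (n - 1) * (\<Sum>i\<le>n. degree (p i))" by simp
  moreover have "(\<Sum>i\<le>n. degree (f i)) = degree (f j) + (\<Sum>i\<in>{..n} - {j}. degree (f i))"
    using j by (simp add: sum.remove[of _ j])
  ultimately show ?thesis using degf[OF j] by simp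
qed

section \<open>The bound on the smallest exponent\<close>

theorem theorem2p3:
  fixes m :: nat and p :: "nat \<Rightarrow> complex poly" and k :: "nat \<Rightarrow> nat"
  assumes "m \<ge> 3"
    and "\<And>i. i \<in> {1..m} \<Longrightarrow> p i \<noteq> 0"
    and "\<And>i. i \<in> {1..m} \<Longrightarrow> k i > 0"
    and "(GCD i\<in>{1..m}. p i ^ k i) = 1"
    and "(\<Sum>i\<in>{1..m}. p i ^ k i) = 0"
    and "\<And>j. j \<in> {1..m} \<Longrightarrow> lin_indep_family ({1..m} - {j}) (\<lambda>i. p i ^ k i)"
  shows "real (Min (k ` {1..m})) < 1 / 3 * (real m ^ 3 + 7 * real m ^ 2 - 49 * real m + 68)"
proof -
  define n where "n = m - 1"
  have m: "m = Suc n" "n \<ge> 2" using assms(1) by (auto simp: n_def)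
  have idx: "{1..m} = Suc ` {..n}" by (simp add: m image_Suc_atMost)
  \<comment> \<open>Indices are shifted to start at 0, so that the Wronskian takes the first
    \<open>n\<close> powers and leaves out the one with index \<open>n\<close>.\<close>
  define P where "P = (\<lambda>i. p (Suc i))"
  define L where "L = (\<lambda>i. k (Suc i))"
  have sum0: "(\<Sum>i\<le>n. P i ^ L i) = 0"
    using assms(5) unfolding idx by (simp add: sum.reindex P_def L_def)
  have nz: "P i \<noteq> 0" if "i \<le> n" for i using assms(2)[of "Suc i"] that by (simp add: P_def m)
  have coprime: "\<exists>j\<le>n. \<not> \<pi> dvd P j" if \<pi>: "prime \<pi>" for \<pi>
  proof (rule ccontr)
    assume "\<not> (\<exists>j\<le>n. \<not> \<pi> dvd P j)"
    then have "\<pi> dvd p i" if "i \<in> {1..m}" for i using that unfolding idx P_def by blast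
    then have "\<pi> dvd p i ^ k i" if "i \<in> {1..m}" for i
      using that assms(3)[OF that] by (meson dvd_power dvd_trans)
    then have "\<pi> dvd (GCD i\<in>{1..m}. p i ^ k i)" by (intro Gcd_greatest) auto
    with assms(4) \<pi> show False by auto
  qed
  have indep: "\<forall>i<n. c i = 0" if "(\<Sum>i<n. smult (c i) (P i ^ L i)) = 0" for c
  proof -
    have *: "{1..m} - {m} = Suc ` {..<n}" by (auto simp: m image_Suc_lessThan)
    have "(\<Sum>i\<in>{1..m} - {m}. smult (c (i - 1)) (p i ^ k i)) = 0"
      using that unfolding * by (simp add: sum.reindex P_def L_def)
    moreover have "lin_indep_family ({1..m} - {m}) (\<lambda>i. p i ^ k i)" using assms(1,6) by simp
    ultimately have "\<forall>i\<in>{1..m} - {m}. c (i - 1) = 0"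
      unfolding lin_indep_family_def by (elim allE[of _ "\<lambda>i. c (i - 1)"] mp)
    then show ?thesis unfolding * by simp
  qed
  have W: "wronskian n (\<lambda>i. P i ^ L i) \<noteq> 0"
    using wronskian_eq_0_imp_dependent[of n "\<lambda>i. P i ^ L i"] indep by blast
  define D where "D = Max ((\<lambda>i. L i * degree (P i)) ` {..n})"
  have D: "L i * degree (P i) \<le> D" if "i \<le> n" for i using that by (auto simp: D_def)
  have "D \<in> (\<lambda>i. L i * degree (P i)) ` {..n}" unfolding D_def by (intro Max_in) auto
  then obtain j where j: "j \<le> n" "D = L j * degree (P j)" by auto
  define K where "K = Min (k ` {1..m})"
  have K: "K \<le> L i" if "i \<le> n" for i using that by (auto simp: K_def L_def m)
  \<comment> \<open>Otherwise all powers are constants, and since \<open>n \<ge> 2\<close> two of an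
    independent family would be proportional. The coefficients \<open>c\<close> express the relation
    \<open>b * a - a * b = 0\<close>.\<close>
  have "D > 0"
  proof (rule ccontr)
    assume "\<not> D > 0"
    then have "degree (P i ^ L i) = 0" if "i \<le> n" for i
      using D[OF that] nz[OF that] by (simp add: degree_power_eq)
    from this[of 0] this[of 1] m obtain a b where ab: "P 0 ^ L 0 = [:a:]" "P 1 ^ L 1 = [:b:]"
      by (metis degree_eq_zeroE le0 le_trans one_le_numeral)
    have "a \<noteq> 0" using ab(1) nz[of 0] by (metis le0 pCons_0_0 power_eq_0_iff)
    define c where "c i = (if i = 0 then b else if i = 1 then - a else 0)" for i :: nat
    have "(\<Sum>i<n. smult (c i) (P i ^ L i)) = (\<Sum>i\<in>{0,1}. smult (c i) (P i ^ L i))"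
      using m by (intro sum.mono_neutral_right) (auto simp: c_def)
    also have "\<dots> = 0" using ab by (simp add: c_def)
    finally have "c 1 = 0" using indep[of c] m by simp
    with \<open>a \<noteq> 0\<close> show False by (simp add: c_def)
  qed
  \<comment> \<open>After multiplication by \<open>K\<close>, each of the \<open>n + 1\<close>
    summands satisfies \<open>K * degree (P i) \<le> L i * degree (P i) \<le> D\<close>, so that
    \<open>D\<close> can be cancelled.\<close>
  have "K * D \<le> K * ((n - 1) * (\<Sum>i\<le>n. degree (P i)))"
    using degree_power_sum_zero_le[OF sum0 nz coprime W j(1)] j(2) by simp
  also have "\<dots> = (n - 1) * (\<Sum>i\<le>n. K * degree (P i))" by (simp add: sum_distrib_left mult_ac)
  also have "\<dots> \<le> (n - 1) * (\<Sum>i\<le>n. D)"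
    using D K by (intro mult_left_mono sum_mono) (auto intro: order_trans[OF mult_right_mono])
  also have "\<dots> = ((n - 1) * (n + 1)) * D" by (cases n) (simp_all add: algebra_simps)
  finally have "K \<le> (n - 1) * (n + 1)" using \<open>D > 0\<close> by (simp only: mult_le_cancel2)
  \<comment> \<open>Here \<open>t = m - 3 \<ge> 0\<close>; in terms of \<open>t\<close> the gap
    between the two bounds is a polynomial with positive coefficients only.\<close>
  define t where "t = n - 2"
  have t: "n = t + 2" using m by (simp add: t_def)
  have "real K \<le> real ((n - 1) * (n + 1))" using \<open>K \<le> _\<close> by (simp only: of_nat_le_iff)
  also have "\<dots> = (real t + 1) * (real t + 3)" by (simp add: t algebra_simps)
  also have "\<dots> < 1 / 3 * (real m ^ 3 + 7 * real m ^ 2 - 49 * real m + 68)"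
  proof -
    have "1 / 3 * (real m ^ 3 + 7 * real m ^ 2 - 49 * real m + 68) - (real t + 1) * (real t + 3)
        = (real (t ^ 3 + 13 * t ^ 2 + 8 * t + 2)) / 3"
      by (simp add: m t power3_eq_cube power2_eq_square field_simps)
    also have "\<dots> > 0" by (simp add: add_pos_nonneg)
    finally show ?thesis by simp
  qed
  finally show ?thesis by (simp add: K_def)
qed

end
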